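(* Let $d\in\{2,3\}$, $N\ge 2$, and consider the Lennard-Jones driven system $$m_i\ddot{\mathbf{x}}_i(t)+c_i\dot{\mathbf{x}}_i(t)=-\nabla_{\mathbf{x}_i}U(\mathbf{x}_1(t),\dots,\mathbf{x}_N(t)),\qquad i=1,\dots,N,$$ where $m_i>0$, $c_i>0$ and $U$ is the total Lennard-Jones potential defined in the context. Let initial data $\mathbf{x}_i(0),\dot{\mathbf{x}}_i(0)\in\mathbb{R}^d$ $(i=1,\dots,N)$ be given with $\mathbf{x}_i(0)\neq\mathbf{x}_j(0)$ for all $i\neq j$, so that the initial total energy $$E_0=\frac12\sum_{i=1}^N m_i\|\dot{\mathbf{x}}_i(0)\|^2+U(\mathbf{x}_1(0),\dots,\mathbf{x}_N(0))$$ satisfies $E_0<\infty$. Then the system has a unique solution with these initial data defined for all $t\ge 0$, and $\mathbf{x}(t)=(\mathbf{x}_1(t),\dots,\mathbf{x}_N(t))\in\mathbb{R}^{dN}\setminus\mathcal{C}$ for all $t\ge 0$.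
   Context: Each agent $i\in\{1,\dots,N\}$ has position $\mathbf{x}_i\in\mathbb{R}^d$, mass $m_i>0$, damping coefficient $c_i>0$ and radius $q_i>0$. For $i\ne j$ put $\sigma_{ij}=\frac{q_i+q_j}{2}$ and $r_{ij}=\|\mathbf{x}_i-\mathbf{x}_j\|$ (Euclidean norm). With a constant $a>0$, the pair potential is $$\phi(\sigma_{ij},r_{ij})=4a\left[\left(\frac{\sigma_{ij}}{r_{ij}}\right)^{12}-\left(\frac{\sigma_{ij}}{r_{ij}}\right)^{6}\right],\qquad r_{ij}>0,$$ and the total potential is $$U(\mathbf{x}_1,\dots,\mathbf{x}_N)=\sum_{i=1}^{N-1}\sum_{j=i+1}^{N}\phi(\sigma_{ij},\|\mathbf{x}_i-\mathbf{x}_j\|).$$ The collision set is $\mathcal{C}=\{\mathbf{x}\in\mathbb{R}^{dN}: \mathbf{x}_i=\mathbf{x}_j\text{ for some } i\ne j\}$; $U$ is defined and smooth on $\mathbb{R}^{dN}\setminus\mathcal{C}$. A solution is a twice continuously differentiable curve taking values in $\mathbb{R}^{dN}\setminus\mathcal{C}$ and satisfying the system (one-sided derivatives at $t=0$). *)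

theory Defs
  imports "HOL-Analysis.Analysis"
begin

text \<open>
  The index type \<open>'d\<close> stands for the coordinates of \<open>\<real>\<^sup>d\<close> and the finite linearly ordered index type
  \<open>'n\<close> for the agents \<open>1 < \<dots> < N\<close>; a configuration is an element of the Euclidean space
  \<open>real ^ 'd ^ 'n\<close>, whose component \<open>x $ i\<close> is the position of agent \<open>i\<close>.
\<close>

type_synonym ('d, 'n) config = "((real, 'd) vec, 'n) vec"

definition LJ_pot :: "real \<Rightarrow> real \<Rightarrow> real \<Rightarrow> real" where
  "LJ_pot a \<sigma> r = 4 * a * ((\<sigma> / r) ^ 12 - (\<sigma> / r) ^ 6)"

definition LJ_sigma :: "('n \<Rightarrow> real) \<Rightarrow> 'n \<Rightarrow> 'n \<Rightarrow> real" where
  "LJ_sigma q i j = (q i + q j) / 2"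

text \<open>
  Since \<open>x / 0 = 0\<close>, the total potential also has a (meaningless) real value at collisions. It is
  only used, and differentiated, at points outside the closed set \<open>collision_set\<close> below.
\<close>

definition LJ_total ::
    "real \<Rightarrow> ('n \<Rightarrow> real) \<Rightarrow> ('d::finite, 'n::{finite,linorder}) config \<Rightarrow> real" where
  "LJ_total a q x = (\<Sum>i\<in>UNIV. \<Sum>j\<in>{i<..}. LJ_pot a (LJ_sigma q i j) (norm (x $ i - x $ j)))"

definition collision_set :: "(('d::finite, 'n::finite) config) set" where
  "collision_set = {x. \<exists>i j. i \<noteq> j \<and> x $ i = x $ j}"

definition LJ_energy ::
    "('n \<Rightarrow> real) \<Rightarrow> real \<Rightarrow> ('n \<Rightarrow> real) \<Rightarrow> ('d::finite, 'n::{finite,linorder}) config \<Rightarrow> ('d, 'n) config \<Rightarrow> real" where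
  "LJ_energy m a q x v = (1 / 2) * (\<Sum>i\<in>UNIV. m i * (norm (v $ i))\<^sup>2) + LJ_total a q x"

definition gradient :: "('a::real_inner \<Rightarrow> real) \<Rightarrow> 'a \<Rightarrow> 'a" where
  "gradient f x = (THE D. GDERIV f x :> D)"

text \<open>The gradient in the block of variables \<open>x $ i\<close>, all other blocks being held fixed.\<close>

definition block_gradient ::
    "'n \<Rightarrow> (('d::finite, 'n::finite) config \<Rightarrow> real) \<Rightarrow> ('d, 'n) config \<Rightarrow> real ^ 'd" where
  "block_gradient i F x = gradient (\<lambda>y. F (\<chi> j. if j = i then y else x $ j)) (x $ i)"

text \<open>
  \<open>X\<close> is a twice continuously differentiable collision-free solution on \<open>[0, \<infinity>)\<close> with initial
  position \<open>x0\<close> and initial velocity \<open>v0\<close>. The derivatives \<open>V\<close> and \<open>A\<close> are taken within \<open>{0..}\<close>,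
  hence one-sided at \<open>0\<close>; the values of \<open>X\<close> at negative times are irrelevant.
\<close>

definition LJ_solution ::
    "('n \<Rightarrow> real) \<Rightarrow> ('n \<Rightarrow> real) \<Rightarrow> real \<Rightarrow> ('n \<Rightarrow> real) \<Rightarrow> ('d::finite, 'n::{finite,linorder}) config \<Rightarrow> ('d, 'n) config
      \<Rightarrow> (real \<Rightarrow> ('d, 'n) config) \<Rightarrow> bool" where
  "LJ_solution m c a q x0 v0 X \<longleftrightarrow>
    (\<exists>V A.
      (\<forall>t\<ge>0. (X has_vector_derivative V t) (at t within {0..})) \<and>
      (\<forall>t\<ge>0. (V has_vector_derivative A t) (at t within {0..})) \<and>
      continuous_on {0..} A \<and>
      (\<forall>t\<ge>0. X t \<notin> collision_set) \<and>
      (\<forall>t\<ge>0. \<forall>i. m i *\<^sub>R (A t $ i) + c i *\<^sub>R (V t $ i) = - block_gradient i (LJ_total a q) (X t)) \<and>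
      X 0 = x0 \<and> V 0 = v0)"

lemma gradient_eqI:
  assumes "GDERIV f x :> D"
  shows "gradient f x = D"
  unfolding gradient_def
proof (rule the_equality)
  show "GDERIV f x :> D" by (fact assms)
next
  fix D' assume "GDERIV f x :> D'"
  with assms have "(\<lambda>h. inner h D') = (\<lambda>h. inner h D)"
    unfolding gderiv_def by (rule has_derivative_unique[rotated])
  then have "inner h (D' - D) = 0" for h
    by (simp add: inner_diff_right fun_eq_iff)
  then show "D' = D"
    using inner_eq_zero_iff[of "D' - D"] by simp
qed

end

theory Submission
  imports Defs "HOL-Real_Asymp.Real_Asymp"
begin

text \<open>
  Written as a function of the squared distance, each pair potential is replaced below a small
  \<open>\<delta>\<close> by its tangent line. The resulting force is globally Lipschitz, so the modified system is
  globally well-posed. Damping makes the energy nonincreasing, and as all pair potentials are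
  bounded below by \<open>- a\<close>, each single pair potential stays below a constant \<open>K\<close> depending only on
  the initial data. If \<open>\<delta>\<close> is chosen such that both the true and the modified potential exceed \<open>K\<close>
  at squared distances up to \<open>\<delta>\<close>, no solution of either system reaches such a distance. At larger
  distances the two systems agree, so existence and uniqueness carry over from the modified to the true one.
\<close>

section \<open>Ordinary differential equations with a globally Lipschitz right-hand side\<close>

text \<open>The mean value theorem on \<open>{0..t}\<close>, phrased for derivatives within
  \<open>{0..}\<close> to fit solutions that are differentiated one-sidedly at 0. It serves both the
  Gronwall argument and the energy estimate.\<close>

lemma nonincreasing_within_nonneg:
  fixes f :: "real \<Rightarrow> real"
  assumes deriv: "\<And>t. t \<ge> 0 \<Longrightarrow> (f has_real_derivative f' t) (at t within {0..})"
    and nonpos: "\<And>t. t \<ge> 0 \<Longrightarrow> f' t \<le> 0"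
    and "t \<ge> 0"
  shows "f t \<le> f 0"
proof -
  have "\<exists>s\<in>{0..t}. f t - f 0 = (f' s * (t - 0))"
  proof (rule mvt_very_simple[OF \<open>t \<ge> 0\<close>])
    fix s assume "0 \<le> s" "s \<le> t"
    then show "(f has_derivative (*) (f' s)) (at s within {0..t})"
      using deriv[of s] has_field_derivative_subset[of f "f' s" s "{0..}" "{0..t}"]
      by (auto simp: has_field_derivative_def)
  qed
  then obtain s where s: "s \<in> {0..t}" "f t - f 0 = f' s * t" by auto
  with nonpos[of s] \<open>t \<ge> 0\<close> have "f' s * t \<le> 0"
    by (intro mult_nonpos_nonneg) auto
  with s show ?thesis by simp
qed

text \<open>Gronwall's argument: \<open>exp (- (2 * L) * t)\<close> times the squared distance of
  two solutions has nonpositive derivative and starts at 0. The square, written as an inner product,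
  is differentiable even where the solutions meet.\<close>

lemma global_lipschitz_ode_unique:
  fixes F :: "'b::real_inner \<Rightarrow> 'b"
  assumes F: "L-lipschitz_on UNIV F"
    and y: "\<And>t. t \<ge> 0 \<Longrightarrow> (y has_vector_derivative F (y t)) (at t within {0..})"
    and z: "\<And>t. t \<ge> 0 \<Longrightarrow> (z has_vector_derivative F (z t)) (at t within {0..})"
    and init: "y 0 = z 0" and "t \<ge> 0"
  shows "y t = z t"
proof -
  define g where "g t = exp (- (2 * L) * t) * ((y t - z t) \<bullet> (y t - z t))" for t
  define g' where "g' t = exp (- (2 * L) * t) *
    (2 * ((y t - z t) \<bullet> (F (y t) - F (z t))) - 2 * L * ((y t - z t) \<bullet> (y t - z t)))" for t
  have "g t \<le> g 0"
  proof (rule nonincreasing_within_nonneg[OF _ _ \<open>t \<ge> 0\<close>, where f' = g'])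
    fix t :: real assume t: "t \<ge> 0"
    show "(g has_real_derivative g' t) (at t within {0..})"
    proof -
      define w w' where "w s = y s - z s" and "w' = F (y t) - F (z t)" for s
      have "((\<lambda>s. y s - z s) has_vector_derivative w') (at t within {0..})"
        unfolding w'_def by (intro derivative_intros y z t)
      then have "((\<lambda>s. w s \<bullet> w s) has_derivative (\<lambda>h. w t \<bullet> (h *\<^sub>R w') + (h *\<^sub>R w') \<bullet> w t)) (at t within {0..})"
        unfolding w_def has_vector_derivative_def by (intro has_derivative_inner) auto
      then have "((\<lambda>s. w s \<bullet> w s) has_real_derivative 2 * (w t \<bullet> w')) (at t within {0..})"
        unfolding has_field_derivative_def
        by (rule has_derivative_eq_rhs) (simp add: fun_eq_iff inner_commute algebra_simps)
      then have "((\<lambda>s. exp (- (2 * L) * s) * (w s \<bullet> w s)) has_real_derivative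
          exp (- (2 * L) * t) * (2 * (w t \<bullet> w') - 2 * L * (w t \<bullet> w t))) (at t within {0..})"
        by (auto intro!: derivative_eq_intros simp: algebra_simps)
      then show ?thesis
        by (simp add: g_def[abs_def] g'_def w_def w'_def)
    qed
    have "(y t - z t) \<bullet> (F (y t) - F (z t)) \<le> norm (y t - z t) * norm (F (y t) - F (z t))"
      by (rule norm_cauchy_schwarz)
    also have "\<dots> \<le> norm (y t - z t) * (L * norm (y t - z t))"
      using lipschitz_onD[OF F, of "y t" "z t"] by (intro mult_left_mono) (auto simp: dist_norm)
    also have "\<dots> = L * ((y t - z t) \<bullet> (y t - z t))"
      by (simp add: power2_norm_eq_inner[symmetric] power2_eq_square)
    finally show "g' t \<le> 0" unfolding g'_def by (intro mult_nonneg_nonpos) auto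
  qed
  also have "g 0 = 0" by (simp add: g_def init)
  finally have "(y t - z t) \<bullet> (y t - z t) \<le> 0"
    by (simp add: g_def mult_le_0_iff)
  then have "(y t - z t) \<bullet> (y t - z t) = 0" by (intro antisym inner_ge_zero)
  then show ?thesis by simp
qed

text \<open>The gain behind the Picard contraction: integrating growth of order
  \<open>exp (l * r)\<close> and then weighting by \<open>exp (- l * s)\<close> leaves the factor
  \<open>1 / l\<close>, uniformly in \<open>s\<close>.\<close>

lemma weighted_integral_exp_le:
  fixes l B s :: real
  assumes "l > 0" "B \<ge> 0" "s \<ge> 0"
  shows "(\<lambda>r. B * exp (l * r)) integrable_on {0..s}"
    and "exp (- l * s) * integral {0..s} (\<lambda>r. B * exp (l * r)) \<le> B / l"
proof -
  have I: "((\<lambda>r. B * exp (l * r)) has_integral (B / l * exp (l * s) - B / l * exp (l * 0))) {0..s}"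
    using assms
    by (intro fundamental_theorem_of_calculus)
      (auto intro!: derivative_eq_intros simp flip: has_real_derivative_iff_has_vector_derivative)
  then show "(\<lambda>r. B * exp (l * r)) integrable_on {0..s}" by blast
  have "exp (- l * s) * integral {0..s} (\<lambda>r. B * exp (l * r))
      = B / l * (exp (- l * s) * exp (l * s)) - B / l * exp (- l * s)"
    unfolding integral_unique[OF I] by (simp add: algebra_simps)
  also have "\<dots> \<le> B / l"
    using assms by (simp flip: exp_add)
  finally show "exp (- l * s) * integral {0..s} (\<lambda>r. B * exp (l * r)) \<le> B / l" .
qed

text \<open>
  In the weighted variable \<open>u t = exp (- l * t) *\<^sub>R z t\<close> with \<open>l\<close> twice the Lipschitz constant, the
  Picard operator contracts the bounded continuous functions on the whole half-line, so a global
  solution is obtained without continuation.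
\<close>

lemma global_lipschitz_ode_exists:
  fixes F :: "'b::banach \<Rightarrow> 'b"
  assumes F: "L-lipschitz_on UNIV F"
  obtains z where "z 0 = z0"
    and "\<And>t. t \<ge> 0 \<Longrightarrow> (z has_vector_derivative F (z t)) (at t within {0..})"
proof -
  \<comment> \<open>Adding 1 keeps \<open>K\<close> and \<open>l\<close> positive even when
    \<open>L = 0\<close>; with \<open>l = 2 * K\<close> the contraction factor \<open>K / l\<close>
    is 1/2.\<close>
  define K where "K = L + 1"
  define l where "l = 2 * K"
  have K: "K > 0" using lipschitz_on_nonneg[OF F] by (simp add: K_def)
  then have l: "l > 0" by (simp add: l_def)
  have FK: "norm (F x - F y) \<le> K * norm (x - y)" for x y
  proof -
    have "norm (F x - F y) \<le> L * norm (x - y)"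
      using lipschitz_onD[OF F, of x y] by (simp add: dist_norm)
    also have "\<dots> \<le> K * norm (x - y)" by (simp add: K_def mult_right_mono)
    finally show ?thesis .
  qed
  have contF: "continuous_on UNIV F" using F by (rule lipschitz_on_continuous_on)
  \<comment> \<open>\<open>G u\<close> is \<open>F\<close> along the unweighted curve, so a fixed
    point of the operator \<open>J\<close> below is the integral equation in weighted form.\<close>
  define G where "G u r = F (exp (l * r) *\<^sub>R apply_bcontfun u r)" for u :: "real \<Rightarrow>\<^sub>C 'b" and r
  have contG: "continuous_on S (G u)" for u S
    unfolding G_def
    by (rule continuous_on_compose2[OF contF]) (auto intro!: continuous_intros)
  have intG: "G u integrable_on {0..s}" for u s
    by (rule integrable_continuous_interval[OF contG])
  \<comment> \<open>Elements of the function space live on the whole line, so \<open>max t 0\<close>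
    extends the operator to negative times by the constant \<open>z0\<close>.\<close>
  define J where "J u t = exp (- l * max t 0) *\<^sub>R (z0 + integral {0..max t 0} (G u))"
    for u :: "real \<Rightarrow>\<^sub>C 'b" and t
  have J: "J u \<in> bcontfun" for u
  proof (rule bcontfun_normI)
    have "continuous_on {0..} (\<lambda>s. integral {0..s} (G u))"
      unfolding continuous_on_eq_continuous_within
    proof
      fix s :: real assume "s \<in> {0..}"
      then have s: "s \<ge> 0" by simp
      \<comment> \<open>Continuity at \<open>s\<close> is local, so the compact interval
        \<open>{0..s+1}\<close> can replace the half-line.\<close>
      have "continuous_on {0..s+1} (\<lambda>s. integral {0..s} (G u))"
        by (rule indefinite_integral_continuous_1[OF intG])
      then have "continuous (at s within {0..s+1}) (\<lambda>s. integral {0..s} (G u))"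
        using s by (simp add: continuous_on_eq_continuous_within)
      moreover have "at s within {0..s+1} = at s within {0..}"
        by (rule at_within_nhd[of _ "{s-1<..<s+1}"]) auto
      ultimately show "continuous (at s within {0..}) (\<lambda>s. integral {0..s} (G u))" by simp
    qed
    then have "continuous_on UNIV (\<lambda>t. integral {0..max t 0} (G u))"
      by (rule continuous_on_compose2) (auto intro!: continuous_intros)
    then show "continuous_on UNIV (J u)"
      unfolding J_def[abs_def] by (intro continuous_intros)
    fix t :: real
    define s where "s = max t 0"
    \<comment> \<open>As \<open>exp (l * r)\<close> is at least 1, it also dominates the constant
      term \<open>norm (F 0)\<close>, and \<open>B * exp (l * r)\<close> covers the whole affine
      growth of \<open>F\<close>.\<close>
    define B where "B = norm (F 0) + K * norm u"
    have s: "s \<ge> 0" and B: "B \<ge> 0" using K by (auto simp: s_def B_def)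
    have "norm (integral {0..s} (G u)) \<le> integral {0..s} (\<lambda>r. B * exp (l * r))"
    proof (rule integral_norm_bound_integral[OF intG weighted_integral_exp_le(1)[OF l B s]])
      fix r assume "r \<in> {0..s}"
      then have e: "1 \<le> exp (l * r)" using l by simp
      have "norm (G u r) \<le> norm (F 0) + K * norm (exp (l * r) *\<^sub>R apply_bcontfun u r)"
        using FK[of "exp (l * r) *\<^sub>R apply_bcontfun u r" 0]
          norm_triangle_sub[of "G u r" "F 0"] by (simp add: G_def)
      also have "\<dots> \<le> norm (F 0) * exp (l * r) + K * (exp (l * r) * norm u)"
        using e K norm_bounded[of u r]
        by (intro add_mono mult_left_mono) (auto simp: mult_le_cancel_left1)
      finally show "norm (G u r) \<le> B * exp (l * r)" by (simp add: B_def algebra_simps)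
    qed
    then have "exp (- l * s) * norm (integral {0..s} (G u))
        \<le> exp (- l * s) * integral {0..s} (\<lambda>r. B * exp (l * r))"
      by (intro mult_left_mono) auto
    also have "\<dots> \<le> B / l" by (rule weighted_integral_exp_le(2)[OF l B s])
    finally have i: "exp (- l * s) * norm (integral {0..s} (G u)) \<le> B / l" .
    have "norm (J u t) = exp (- l * s) * norm (z0 + integral {0..s} (G u))"
      by (simp add: J_def s_def)
    also have "\<dots> \<le> exp (- l * s) * (norm z0 + norm (integral {0..s} (G u)))"
      by (intro mult_left_mono norm_triangle_ineq) auto
    also have "\<dots> \<le> 1 * norm z0 + B / l"
      using i l s unfolding distrib_left
      by (intro add_mono mult_right_mono) auto
    finally show "norm (J u t) \<le> 1 * norm z0 + (norm (F 0) + K * norm u) / l" by (simp add: B_def)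
  qed
  define P where "P u = Bcontfun (J u)" for u
  have P: "apply_bcontfun (P u) t = J u t" for u t
    by (simp add: P_def Bcontfun_inverse[OF J])
  have "\<exists>!u. P u = u"
  proof (rule banach_fix_type)
    show "0 \<le> (1/2::real)" "(1/2::real) < 1" by auto
    show "\<forall>u v. dist (P u) (P v) \<le> 1/2 * dist u v"
    proof (intro allI dist_bound)
      fix u v :: "real \<Rightarrow>\<^sub>C 'b" and t :: real
      define s where "s = max t 0"
      define B where "B = K * dist u v"
      have s: "s \<ge> 0" and B: "B \<ge> 0" using K by (simp_all add: s_def B_def)
      have "norm (integral {0..s} (\<lambda>r. G u r - G v r)) \<le> integral {0..s} (\<lambda>r. B * exp (l * r))"
      proof (rule integral_norm_bound_integral[OF integrable_diff[OF intG intG]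
            weighted_integral_exp_le(1)[OF l B s]])
        fix r
        have "norm (G u r - G v r)
            \<le> K * norm (exp (l * r) *\<^sub>R (apply_bcontfun u r - apply_bcontfun v r))"
          unfolding G_def scaleR_diff_right by (rule FK)
        also have "\<dots> \<le> K * (exp (l * r) * dist u v)"
          using K dist_bounded[of u r v]
          by (intro mult_left_mono) (auto simp: dist_norm)
        finally show "norm (G u r - G v r) \<le> B * exp (l * r)" by (simp add: B_def algebra_simps)
      qed
      then have "exp (- l * s) * norm (integral {0..s} (G u) - integral {0..s} (G v))
          \<le> exp (- l * s) * integral {0..s} (\<lambda>r. B * exp (l * r))"
        by (intro mult_left_mono) (auto simp: integral_diff[OF intG intG])
      also have "\<dots> \<le> B / l" by (rule weighted_integral_exp_le(2)[OF l B s])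
      also have "\<dots> = 1/2 * dist u v" using K by (simp add: B_def l_def)
      finally show "dist (apply_bcontfun (P u) t) (apply_bcontfun (P v) t) \<le> 1/2 * dist u v"
        by (simp add: P J_def dist_norm flip: s_def scaleR_diff_right)
    qed
  qed
  then obtain u where u: "P u = u" by blast
  define z where "z t = exp (l * t) *\<^sub>R apply_bcontfun u t" for t
  have z: "z t = z0 + integral {0..t} (G u)" if "t \<ge> 0" for t
  proof -
    have "z t = exp (l * t) *\<^sub>R J u t" by (metis P u z_def)
    also have "\<dots> = (exp (l * t) * exp (- l * t)) *\<^sub>R (z0 + integral {0..t} (G u))"
      using that by (simp add: J_def)
    finally show ?thesis by (simp flip: exp_add)
  qed
  show ?thesis
  proof
    show "z 0 = z0" by (simp add: z)
    fix t :: real assume t: "t \<ge> 0"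
    have "((\<lambda>t. integral {0..t} (G u)) has_vector_derivative G u t) (at t within {0..t+1})"
      using t by (intro integral_has_vector_derivative contG) auto
    moreover have "at t within {0..t+1} = at t within {0..}"
      by (rule at_within_nhd[of _ "{t-1<..<t+1}"]) auto
    ultimately have "((\<lambda>t. z0 + integral {0..t} (G u)) has_vector_derivative G u t) (at t within {0..})"
      by (auto intro!: derivative_eq_intros)
    then have "(z has_vector_derivative G u t) (at t within {0..})"
      by (rule has_vector_derivative_transform[rotated 2]) (use t in \<open>auto simp: z\<close>)
    then show "(z has_vector_derivative F (z t)) (at t within {0..})" by (simp add: G_def z_def)
  qed
qed

section \<open>Globally Lipschitz functions\<close>

text \<open>The constant is hidden because well-posedness only asks that one exists; the closure
  properties then chain without bookkeeping.\<close>

definition lipschitzian :: "('a::metric_space \<Rightarrow> 'b::metric_space) \<Rightarrow> bool" where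
  "lipschitzian f \<longleftrightarrow> (\<exists>L. L-lipschitz_on UNIV f)"

lemma lipschitzianI:
  assumes "\<And>x y. dist (f x) (f y) \<le> L * dist x y"
  shows "lipschitzian f"
proof -
  have "dist (f x) (f y) \<le> \<bar>L\<bar> * dist x y" for x y
    using assms[of x y] by (rule order_trans) (simp add: mult_right_mono)
  then show ?thesis
    unfolding lipschitzian_def by (intro exI[of _ "\<bar>L\<bar>"] lipschitz_onI) auto
qed

lemma lipschitzian_comp:
  "lipschitzian f \<Longrightarrow> lipschitzian g \<Longrightarrow> lipschitzian (\<lambda>x. f (g x))"
  unfolding lipschitzian_def by (blast intro: lipschitz_on_compose2 lipschitz_on_subset)

lemma lipschitzian_const: "lipschitzian (\<lambda>x. c)"
  by (rule lipschitzianI[of _ 0]) simp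

lemma lipschitzian_bounded_linear: "bounded_linear f \<Longrightarrow> lipschitzian f"
  unfolding lipschitzian_def by (metis bounded_linear.lipschitz_boundE)

lemma lipschitzian_add:
  fixes f g :: "'a::metric_space \<Rightarrow> 'b::real_normed_vector"
  shows "lipschitzian f \<Longrightarrow> lipschitzian g \<Longrightarrow> lipschitzian (\<lambda>x. f x + g x)"
  unfolding lipschitzian_def by (blast intro: lipschitz_on_add)

lemma lipschitzian_sum:
  fixes f :: "'i \<Rightarrow> 'a::metric_space \<Rightarrow> 'b::real_normed_vector"
  shows "(\<And>i. i \<in> I \<Longrightarrow> lipschitzian (f i)) \<Longrightarrow> lipschitzian (\<lambda>x. \<Sum>i\<in>I. f i x)"
  by (induction I rule: infinite_finite_induct) (auto intro: lipschitzian_const lipschitzian_add)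

lemma lipschitzian_Pair:
  "lipschitzian f \<Longrightarrow> lipschitzian g \<Longrightarrow> lipschitzian (\<lambda>x. (f x, g x))"
  unfolding lipschitzian_def by (blast intro: lipschitz_on_Pair)

lemma lipschitzian_vec_lambda:
  fixes f :: "'n::finite \<Rightarrow> 'a::metric_space \<Rightarrow> 'b::real_normed_vector"
  assumes "\<And>i. lipschitzian (f i)"
  shows "lipschitzian (\<lambda>x. \<chi> i. f i x)"
proof -
  obtain L where L: "\<And>i. (L i)-lipschitz_on UNIV (f i)"
    using assms unfolding lipschitzian_def by metis
  have "dist (\<chi> i. f i x) (\<chi> i. f i y) \<le> (\<Sum>i\<in>UNIV. L i) * dist x y" for x y
  proof -
    have "dist (\<chi> i. f i x) (\<chi> i. f i y) \<le> (\<Sum>i\<in>UNIV. dist (f i x) (f i y))"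
      by (simp add: dist_vec_def L2_set_le_sum)
    also have "\<dots> \<le> (\<Sum>i\<in>UNIV. L i * dist x y)"
      by (intro sum_mono lipschitz_onD[OF L]) auto
    finally show ?thesis by (simp add: sum_distrib_right)
  qed
  then show ?thesis by (rule lipschitzianI)
qed

text \<open>Products of Lipschitz functions need not be globally Lipschitz; bounds on both factors
  make the usual splitting of the difference a global estimate.\<close>

lemma lipschitzian_bounded_scaleR:
  fixes f :: "'a::metric_space \<Rightarrow> real" and g :: "'a \<Rightarrow> 'b::real_normed_vector"
  assumes f: "lipschitzian f" "\<And>x. \<bar>f x\<bar> \<le> B" and g: "lipschitzian g" "\<And>x. norm (g x) \<le> C"
  shows "lipschitzian (\<lambda>x. f x *\<^sub>R g x)"
proof -
  obtain M L where M: "M-lipschitz_on UNIV f" and L: "L-lipschitz_on UNIV g"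
    using f g unfolding lipschitzian_def by blast
  have "dist (f x *\<^sub>R g x) (f y *\<^sub>R g y) \<le> (B * L + C * M) * dist x y" for x y
  proof -
    have "f x *\<^sub>R g x - f y *\<^sub>R g y = f x *\<^sub>R (g x - g y) + (f x - f y) *\<^sub>R g y"
      by (simp add: algebra_simps)
    then have "dist (f x *\<^sub>R g x) (f y *\<^sub>R g y)
        \<le> \<bar>f x\<bar> * dist (g x) (g y) + dist (f x) (f y) * norm (g y)"
      by (metis dist_norm norm_scaleR norm_triangle_ineq real_norm_def)
    also have "\<dots> \<le> B * (L * dist x y) + (M * dist x y) * C"
      using f(2)[of x] g(2)[of y] lipschitz_onD[OF L, of x y] lipschitz_onD[OF M, of x y]
        lipschitz_on_nonneg[OF M]
      by (intro add_mono mult_mono) auto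
    finally show ?thesis by (simp add: algebra_simps)
  qed
  then show ?thesis by (rule lipschitzianI)
qed

text \<open>Building blocks of the modified force: the unit vector and the inverse distance, with
  the norm cut off from below at \<open>e\<close>. The cut-off unit vector needs a direct estimate,
  since its factor \<open>y\<close> is unbounded and the product rule above does not apply.\<close>

lemma lipschitzian_cut_unit:
  fixes e :: real
  assumes "e > 0"
  shows "lipschitzian (\<lambda>y::'a::real_normed_vector. inverse (max (norm y) e) *\<^sub>R y)"
    and "\<And>y::'a. norm (inverse (max (norm y) e) *\<^sub>R y) \<le> 1"
    and "lipschitzian (\<lambda>y::'a. inverse (max (norm y) e))"
    and "\<And>y::'a. \<bar>inverse (max (norm y) e)\<bar> \<le> inverse e"
proof -
  let ?r = "\<lambda>y::'a. max (norm y) e"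
  have pos: "?r y > 0" and ge: "?r y \<ge> e" "?r y \<ge> norm y" for y using assms by auto
  show inv: "\<bar>inverse (?r y)\<bar> \<le> inverse e" for y
    using assms pos[of y] by (simp add: le_imp_inverse_le)
  show unit: "norm (inverse (?r y) *\<^sub>R y) \<le> 1" for y
    using pos[of y] ge(2)[of y] by (simp add: field_simps)
  have diff: "\<bar>?r y - ?r z\<bar> \<le> dist y z" for y z
    using norm_triangle_ineq3[of y z] by (auto simp: dist_norm max_def)
  have inv_diff: "\<bar>inverse (?r y) - inverse (?r z)\<bar> = inverse (?r y) * \<bar>?r y - ?r z\<bar> * inverse (?r z)" for y z
    using pos[of y] pos[of z] inverse_diff_inverse[of "?r y" "?r z"] by (simp add: abs_mult)
  show "lipschitzian (\<lambda>y. inverse (?r y))"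
  proof (rule lipschitzianI)
    fix y z
    have "\<bar>inverse (?r y) - inverse (?r z)\<bar> \<le> inverse e * dist y z * inverse e"
      unfolding inv_diff using inv[of y] inv[of z] diff[of y z] assms
      by (intro mult_mono) auto
    then show "dist (inverse (?r y)) (inverse (?r z)) \<le> (inverse e * inverse e) * dist y z"
      by (simp add: dist_real_def algebra_simps)
  qed
  show "lipschitzian (\<lambda>y. inverse (?r y) *\<^sub>R y)"
  proof (rule lipschitzianI)
    fix y z
    have "inverse (?r y) *\<^sub>R y - inverse (?r z) *\<^sub>R z
        = inverse (?r y) *\<^sub>R (y - z) + (inverse (?r y) - inverse (?r z)) *\<^sub>R z"
      by (simp add: algebra_simps)
    then have "dist (inverse (?r y) *\<^sub>R y) (inverse (?r z) *\<^sub>R z)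
        \<le> \<bar>inverse (?r y)\<bar> * dist y z + \<bar>inverse (?r y) - inverse (?r z)\<bar> * norm z"
      by (metis dist_norm norm_scaleR norm_triangle_ineq)
    \<comment> \<open>The unbounded factor \<open>norm z\<close> is absorbed by
      \<open>inverse (?r z)\<close>, because \<open>?r z\<close> is at least
      \<open>norm z\<close>.\<close>
    also have "\<bar>inverse (?r y) - inverse (?r z)\<bar> * norm z
        = inverse (?r y) * \<bar>?r y - ?r z\<bar> * norm (inverse (?r z) *\<^sub>R z)"
      unfolding inv_diff using pos[of z] by simp
    also have "\<dots> \<le> inverse e * dist y z * 1"
      using inv[of y] unit[of z] diff[of y z] assms
      by (intro mult_mono) auto
    also have "\<bar>inverse (?r y)\<bar> * dist y z \<le> inverse e * dist y z"
      using inv[of y] by (intro mult_right_mono) auto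
    finally show "dist (inverse (?r y) *\<^sub>R y) (inverse (?r z) *\<^sub>R z) \<le> (2 * inverse e) * dist y z"
      by simp
  qed
qed

text \<open>Each further inverse power multiplies a bounded Lipschitz function by another one. The
  bound is proved first, for all exponents, because the induction step uses it.\<close>

lemma lipschitzian_cut_power:
  fixes e :: real
  assumes "e > 0"
  shows "lipschitzian (\<lambda>y::'a::real_normed_vector. inverse (max (norm y) e) ^ n *\<^sub>R (inverse (max (norm y) e) *\<^sub>R y))"
    and "\<And>y::'a. norm (inverse (max (norm y) e) ^ n *\<^sub>R (inverse (max (norm y) e) *\<^sub>R y)) \<le> inverse e ^ n"
proof -
  let ?r = "\<lambda>y::'a. max (norm y) e"
  note cut = lipschitzian_cut_unit[OF assms, where 'a = 'a]
  show bound: "norm (inverse (?r y) ^ n *\<^sub>R (inverse (?r y) *\<^sub>R y)) \<le> inverse e ^ n" for y n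
  proof -
    have "norm (inverse (?r y) ^ n *\<^sub>R (inverse (?r y) *\<^sub>R y))
        = \<bar>inverse (?r y)\<bar> ^ n * norm (inverse (?r y) *\<^sub>R y)"
      by (simp only: norm_scaleR power_abs real_norm_def)
    also have "\<dots> \<le> inverse e ^ n * 1"
      using cut(4)[of y] cut(2)[of y] assms by (intro mult_mono power_mono) auto
    finally show ?thesis by simp
  qed
  show "lipschitzian (\<lambda>y. inverse (?r y) ^ n *\<^sub>R (inverse (?r y) *\<^sub>R y))"
  proof (induction n)
    case 0
    show ?case using cut(1) by simp
  next
    case (Suc n)
    have "lipschitzian (\<lambda>y. inverse (?r y) *\<^sub>R (inverse (?r y) ^ n *\<^sub>R (inverse (?r y) *\<^sub>R y)))"
      by (rule lipschitzian_bounded_scaleR[OF cut(3) cut(4) Suc bound])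
    then show ?case by (simp add: mult.assoc)
  qed
qed

section \<open>Energy of damped systems with pair potentials\<close>

text \<open>The profile \<open>p\<close> is left abstract so that the true and the modified
  potential share one energy argument; it takes the squared distance.\<close>

definition pair_total ::
    "('n \<Rightarrow> 'n \<Rightarrow> real \<Rightarrow> real) \<Rightarrow> ('d::finite, 'n::{finite,linorder}) config \<Rightarrow> real" where
  "pair_total p x = (\<Sum>i\<in>UNIV. \<Sum>j\<in>{i<..}. p i j ((norm (x $ i - x $ j))\<^sup>2))"

text \<open>\<open>p'\<close> stands for the derivative of the profile in the squared distance,
  which explains the factor 2.\<close>

definition pair_gradient ::
    "('n \<Rightarrow> 'n \<Rightarrow> real \<Rightarrow> real) \<Rightarrow> ('d::finite, 'n::finite) config \<Rightarrow> ('d, 'n) config" where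
  "pair_gradient p' x =
    (\<chi> i. \<Sum>j\<in>UNIV - {i}. (2 * p' i j ((norm (x $ i - x $ j))\<^sup>2)) *\<^sub>R (x $ i - x $ j))"

text \<open>Newton's third law: by antisymmetry the pair \<open>i < j\<close> contributes
  \<open>D i j\<close> to agent \<open>i\<close> and \<open>D j i\<close> to agent \<open>j\<close>.
  Exchanging the sums in the second contribution supplies the partners with smaller index.\<close>

lemma sum_pairs_antisym:
  fixes D :: "'n::{finite,linorder} \<Rightarrow> 'n \<Rightarrow> 'b::real_inner"
  assumes anti: "\<And>i j. D j i = - D i j"
  shows "(\<Sum>i\<in>UNIV. \<Sum>j\<in>{i<..}. D i j \<bullet> (h i - h j)) = (\<Sum>i\<in>UNIV. (\<Sum>j\<in>UNIV - {i}. D i j) \<bullet> h i)"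
proof -
  have "(\<Sum>i\<in>UNIV. \<Sum>j\<in>{i<..}. D i j \<bullet> (h i - h j))
      = (\<Sum>i\<in>UNIV. \<Sum>j\<in>{i<..}. D i j \<bullet> h i) + (\<Sum>i\<in>UNIV. \<Sum>j\<in>{i<..}. D j i \<bullet> h j)"
  proof -
    have "D i j \<bullet> (h i - h j) = D i j \<bullet> h i + D j i \<bullet> h j" for i j
      by (simp add: anti[of i j] inner_diff_right)
    then show ?thesis by (simp add: sum.distrib)
  qed
  also have "(\<Sum>i\<in>UNIV. \<Sum>j\<in>{i<..}. D j i \<bullet> h j) = (\<Sum>j\<in>UNIV. \<Sum>i\<in>{..<j}. D j i \<bullet> h j)"
    using sum.swap_restrict[of UNIV UNIV "\<lambda>i j. D j i \<bullet> h j" "(<)"]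
    by (simp add: greaterThan_def lessThan_def)
  also have "(\<Sum>i\<in>UNIV. \<Sum>j\<in>{i<..}. D i j \<bullet> h i) + \<dots>
      = (\<Sum>i\<in>UNIV. \<Sum>j\<in>{i<..} \<union> {..<i}. D i j \<bullet> h i)"
    by (subst sum.union_disjoint) (auto simp: sum.distrib)
  also have "\<dots> = (\<Sum>i\<in>UNIV. (\<Sum>j\<in>UNIV - {i}. D i j) \<bullet> h i)"
    unfolding inner_sum_left by (intro sum.cong) auto
  finally show ?thesis .
qed

text \<open>Chain rule through the squared distances. Differentiability of \<open>p\<close> is asked
  only at the distances present in \<open>x\<close>, so the Lennard-Jones profile qualifies at every
  collision-free configuration.\<close>

lemma GDERIV_pair_total:
  fixes x :: "('d::finite, 'n::{finite,linorder}) config"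
  assumes sym: "\<And>i j s. p' i j s = p' j i s"
    and deriv: "\<And>i j. i \<noteq> j \<Longrightarrow>
      (p i j has_real_derivative p' i j ((norm (x $ i - x $ j))\<^sup>2)) (at ((norm (x $ i - x $ j))\<^sup>2))"
  shows "GDERIV (pair_total p) x :> pair_gradient p' x"
proof -
  define D where "D i j = (2 * p' i j ((norm (x $ i - x $ j))\<^sup>2)) *\<^sub>R (x $ i - x $ j)" for i j
  have anti: "D j i = - D i j" for i j
    by (simp add: D_def sym[of j i] norm_minus_commute[of "x $ j"] flip: scaleR_minus_right)
  have pair: "((\<lambda>x. p i j ((norm (x $ i - x $ j))\<^sup>2)) has_derivative (\<lambda>h. D i j \<bullet> (h $ i - h $ j))) (at x)"
    if "i \<noteq> j" for i j
  proof -
    have "((\<lambda>x. x $ i - x $ j) has_derivative (\<lambda>h. h $ i - h $ j)) (at x)"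
      by (intro derivative_intros bounded_linear_imp_has_derivative bounded_linear_vec_nth)
    from has_derivative_inner[OF this this]
    have "((\<lambda>x. (norm (x $ i - x $ j))\<^sup>2) has_derivative (\<lambda>h. 2 * ((x $ i - x $ j) \<bullet> (h $ i - h $ j)))) (at x)"
      unfolding power2_norm_eq_inner
      by (rule has_derivative_eq_rhs) (simp add: fun_eq_iff inner_commute)
    from has_derivative_compose[OF this deriv[OF that, unfolded has_field_derivative_def]]
    show ?thesis
      by (rule has_derivative_eq_rhs) (simp add: D_def fun_eq_iff)
  qed
  have "(pair_total p has_derivative (\<lambda>h. \<Sum>i\<in>UNIV. \<Sum>j\<in>{i<..}. D i j \<bullet> (h $ i - h $ j))) (at x)"
    unfolding pair_total_def[abs_def] by (intro has_derivative_sum pair) auto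
  then show ?thesis
    unfolding gderiv_def sum_pairs_antisym[of D, OF anti]
    by (rule has_derivative_eq_rhs)
      (simp add: fun_eq_iff inner_vec_def pair_gradient_def D_def mult.commute)
qed

text \<open>Varying block \<open>i\<close> alone is an affine map with linear part
  \<open>axis i\<close>, and the inner product of \<open>axis i h\<close> with \<open>D\<close> is
  that of \<open>h\<close> with \<open>D $ i\<close>.\<close>

lemma block_gradient_eqI:
  fixes x :: "('d::finite, 'n::finite) config"
  assumes "GDERIV F x :> D"
  shows "block_gradient i F x = D $ i"
  unfolding block_gradient_def
proof (rule gradient_eqI)
  have block: "(\<chi> j. if j = i then y else x $ j) = x + axis i (y - x $ i)" for y
    by (simp add: vec_eq_iff axis_def)
  have axis: "bounded_linear (axis i :: real ^ 'd \<Rightarrow> real ^ 'd ^ 'n)"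
    unfolding linear_conv_bounded_linear[symmetric]
    by (intro linearI) (auto simp: vec_eq_iff axis_def)
  have "((\<lambda>y. y - x $ i) has_derivative (\<lambda>h. h)) (at (x $ i))"
    by (auto intro!: derivative_eq_intros)
  from has_derivative_add[OF has_derivative_const bounded_linear.has_derivative[OF axis this]]
  have "((\<lambda>y. x + axis i (y - x $ i)) has_derivative axis i) (at (x $ i))"
    by simp
  moreover have "(F has_derivative (\<lambda>h. h \<bullet> D)) (at (x + axis i (x $ i - x $ i)))"
    using assms by (simp add: gderiv_def axis_def vec_eq_iff[symmetric] flip: zero_vec_def)
  ultimately show "GDERIV (\<lambda>y. F (\<chi> j. if j = i then y else x $ j)) (x $ i) :> D $ i"
    unfolding gderiv_def block
    by (auto dest: has_derivative_compose simp: inner_axis')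
qed

text \<open>The energy balance: kinetic plus potential energy changes at the rate
  \<open>- c i * (norm (V t $ i))\<^sup>2\<close>, summed over the agents.\<close>

lemma damped_energy_nonincreasing:
  fixes X :: "real \<Rightarrow> ('d::finite, 'n::{finite,linorder}) config"
  assumes X: "\<And>t. t \<ge> 0 \<Longrightarrow> (X has_vector_derivative V t) (at t within {0..})"
    and V: "\<And>t. t \<ge> 0 \<Longrightarrow> (V has_vector_derivative A t) (at t within {0..})"
    and W: "\<And>t. t \<ge> 0 \<Longrightarrow> GDERIV W (X t) :> G t"
    and eq: "\<And>t i. t \<ge> 0 \<Longrightarrow> m i *\<^sub>R (A t $ i) + c i *\<^sub>R (V t $ i) = - G t $ i"
    and c: "\<And>i. c i \<ge> 0" and "t \<ge> 0"
  shows "1 / 2 * (\<Sum>i\<in>UNIV. m i * (norm (V t $ i))\<^sup>2) + W (X t)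
    \<le> 1 / 2 * (\<Sum>i\<in>UNIV. m i * (norm (V 0 $ i))\<^sup>2) + W (X 0)"
proof (rule nonincreasing_within_nonneg[OF _ _ \<open>t \<ge> 0\<close>])
  fix t :: real assume t: "t \<ge> 0"
  have V2: "((\<lambda>t. (norm (V t $ i))\<^sup>2) has_derivative (\<lambda>h. h * (2 * (V t $ i \<bullet> A t $ i)))) (at t within {0..})" for i
  proof -
    have "((\<lambda>t. V t $ i) has_derivative (\<lambda>h. h *\<^sub>R (A t $ i))) (at t within {0..})"
      using bounded_linear.has_derivative[OF bounded_linear_vec_nth V[OF t, unfolded has_vector_derivative_def], of i]
      by simp
    from has_derivative_inner[OF this this] show ?thesis
      unfolding power2_norm_eq_inner
      by (rule has_derivative_eq_rhs) (simp add: fun_eq_iff inner_commute algebra_simps)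
  qed
  have WX: "((\<lambda>t. W (X t)) has_derivative (\<lambda>h. (h *\<^sub>R V t) \<bullet> G t)) (at t within {0..})"
    by (rule has_derivative_compose[OF X[OF t, unfolded has_vector_derivative_def] W[OF t, unfolded gderiv_def]])
  \<comment> \<open>Obtained by taking the inner product of the equation of motion with the
    velocity.\<close>
  have rate: "m i * (V t $ i \<bullet> A t $ i) + V t $ i \<bullet> G t $ i = - (c i * (norm (V t $ i))\<^sup>2)" for i
  proof -
    have "V t $ i \<bullet> (m i *\<^sub>R (A t $ i) + c i *\<^sub>R (V t $ i)) = V t $ i \<bullet> (- G t $ i)"
      by (simp only: eq[OF t])
    then show ?thesis by (simp add: inner_add_right power2_norm_eq_inner)
  qed
  have "((\<lambda>t. 1 / 2 * (\<Sum>i\<in>UNIV. m i * (norm (V t $ i))\<^sup>2) + W (X t)) has_derivative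
      (\<lambda>h. 1 / 2 * (\<Sum>i\<in>UNIV. m i * (h * (2 * (V t $ i \<bullet> A t $ i)))) + (h *\<^sub>R V t) \<bullet> G t)) (at t within {0..})"
    by (intro has_derivative_add has_derivative_mult_right has_derivative_sum V2 WX)
  moreover have "(1 / 2 * (\<Sum>i\<in>UNIV. m i * (h * (2 * (V t $ i \<bullet> A t $ i)))) + (h *\<^sub>R V t) \<bullet> G t)
      = (\<Sum>i\<in>UNIV. - (c i * (norm (V t $ i))\<^sup>2)) * h" for h
  proof -
    have "(1 / 2 * (\<Sum>i\<in>UNIV. m i * (h * (2 * (V t $ i \<bullet> A t $ i)))) + (h *\<^sub>R V t) \<bullet> G t)
       = (\<Sum>i\<in>UNIV. (m i * (V t $ i \<bullet> A t $ i) + V t $ i \<bullet> G t $ i)) * h"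
      by (simp add: inner_vec_def sum_distrib_left sum_distrib_right sum.distrib algebra_simps)
    then show ?thesis by (simp only: rate)
  qed
  ultimately show "((\<lambda>t. 1 / 2 * (\<Sum>i\<in>UNIV. m i * (norm (V t $ i))\<^sup>2) + W (X t)) has_real_derivative
      (\<Sum>i\<in>UNIV. - (c i * (norm (V t $ i))\<^sup>2))) (at t within {0..})"
    by (simp add: has_field_derivative_def)
  show "(\<Sum>i\<in>UNIV. - (c i * (norm (V t $ i))\<^sup>2)) \<le> 0"
    by (intro sum_nonpos) (simp add: c)
qed

text \<open>Shifting every term by \<open>b\<close> makes all of them nonnegative, so one term is at
  most the sum. The number of pairs is estimated crudely by the square of the number of
  agents.\<close>

lemma pair_le_pair_total:
  fixes x :: "('d::finite, 'n::{finite,linorder}) config"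
  assumes sym: "\<And>i j s. p i j s = p j i s"
    and lower: "\<And>i j. i \<noteq> j \<Longrightarrow> - b \<le> p i j ((norm (x $ i - x $ j))\<^sup>2)"
    and "b \<ge> 0" "k \<noteq> l"
  shows "p k l ((norm (x $ k - x $ l))\<^sup>2) \<le> pair_total p x + b * (real CARD('n))\<^sup>2"
proof -
  define f where "f i j = p i j ((norm (x $ i - x $ j))\<^sup>2)" for i j
  have f: "f k l = f l k" for k l by (simp add: f_def norm_minus_commute sym[of k])
  have f_le: "f k l + b \<le> (\<Sum>i\<in>UNIV. \<Sum>j\<in>{i<..}. f i j + b)" if "k < l" for k l
  proof -
    have nonneg: "0 \<le> f i j + b" if "j \<in> {i<..}" for i j
    proof -
      have "i \<noteq> j" using that by auto
      from lower[OF this] show ?thesis by (simp add: f_def)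
    qed
    have "f k l + b \<le> (\<Sum>j\<in>{k<..}. f k j + b)"
      using that by (intro member_le_sum nonneg) auto
    also have "\<dots> \<le> (\<Sum>i\<in>UNIV. \<Sum>j\<in>{i<..}. f i j + b)"
      by (intro member_le_sum[of k UNIV "\<lambda>i. \<Sum>j\<in>{i<..}. f i j + b"] sum_nonneg nonneg) auto
    finally show ?thesis .
  qed
  have "f k l + b \<le> (\<Sum>i\<in>UNIV. \<Sum>j\<in>{i<..}. f i j + b)"
    using f_le[of k l] f_le[of l k] \<open>k \<noteq> l\<close> f[of k l] by (cases "k < l") auto
  also have "\<dots> = pair_total p x + (\<Sum>i\<in>(UNIV :: 'n set). real (card {i<..}) * b)"
    by (simp add: pair_total_def f_def sum.distrib)
  also have "(\<Sum>i\<in>(UNIV :: 'n set). real (card {i<..}) * b) \<le> (\<Sum>i\<in>(UNIV :: 'n set). real CARD('n) * b)"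
    using \<open>b \<ge> 0\<close> by (intro sum_mono mult_right_mono) (auto intro!: card_mono)
  finally show ?thesis using \<open>b \<ge> 0\<close> by (simp add: f_def power2_eq_square mult_ac)
qed

section \<open>The Lennard-Jones potential\<close>

text \<open>The argument \<open>s\<close> is the squared distance, a polynomial in the positions, so that the norm need not be
  differentiated.\<close>

definition LJ_sq :: "real \<Rightarrow> real \<Rightarrow> real \<Rightarrow> real" where
  "LJ_sq a \<sigma> s = 4 * a * ((\<sigma> ^ 6 / s ^ 3)\<^sup>2 - \<sigma> ^ 6 / s ^ 3)"

definition LJ_sq' :: "real \<Rightarrow> real \<Rightarrow> real \<Rightarrow> real" where
  "LJ_sq' a \<sigma> s = 12 * a * (\<sigma> ^ 6 / s ^ 4 - 2 * \<sigma> ^ 12 / s ^ 7)"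

text \<open>The case distinction is written as membership in \<open>{..\<delta>}\<close> to match
  the library rule for derivatives of glued functions.\<close>

definition LJ_cut :: "real \<Rightarrow> real \<Rightarrow> real \<Rightarrow> real \<Rightarrow> real" where
  "LJ_cut a \<delta> \<sigma> s = (if s \<in> {..\<delta>} then LJ_sq a \<sigma> \<delta> + LJ_sq' a \<sigma> \<delta> * (s - \<delta>) else LJ_sq a \<sigma> s)"

text \<open>This includes \<open>v = 0\<close>, where division by zero makes both sides 0.\<close>

lemma LJ_pot_norm: "LJ_pot a \<sigma> (norm v) = LJ_sq a \<sigma> ((norm v)\<^sup>2)"
  by (simp add: LJ_pot_def LJ_sq_def power_divide flip: power_mult)

text \<open>Completing the square in \<open>u = \<sigma> ^ 6 / s ^ 3\<close> turns
  \<open>LJ_sq a \<sigma> s + a\<close> into \<open>a * (2 * u - 1)\<^sup>2\<close>. The sign of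
  \<open>s\<close> does not enter.\<close>

lemma LJ_sq_ge:
  assumes "a > 0"
  shows "- a \<le> LJ_sq a \<sigma> s"
proof -
  define u where "u = \<sigma> ^ 6 / s ^ 3"
  have "LJ_sq a \<sigma> s + a = a * (2 * u - 1)\<^sup>2"
    by (simp add: LJ_sq_def power2_eq_square algebra_simps flip: u_def)
  moreover have "a * (2 * u - 1)\<^sup>2 \<ge> 0" using assms by simp
  ultimately show ?thesis by linarith
qed

lemma LJ_sq_deriv:
  assumes "s > 0"
  shows "(LJ_sq a \<sigma> has_real_derivative LJ_sq' a \<sigma> s) (at s within S)"
proof -
  have "((\<lambda>s. 4 * a * (\<sigma> ^ 12 * inverse s ^ 6 - \<sigma> ^ 6 * inverse s ^ 3)) has_real_derivative LJ_sq' a \<sigma> s) (at s within S)"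
    using assms
    by (auto intro!: derivative_eq_intros simp: LJ_sq'_def field_simps eval_nat_numeral)
  moreover have "LJ_sq a \<sigma> = (\<lambda>s. 4 * a * (\<sigma> ^ 12 * inverse s ^ 6 - \<sigma> ^ 6 * inverse s ^ 3))"
    by (simp add: fun_eq_iff LJ_sq_def field_simps flip: power_mult)
  ultimately show ?thesis by simp
qed

text \<open>The closures of the two pieces meet only at \<open>\<delta>\<close>, where values and
  slopes agree, so the glued function is differentiable everywhere.\<close>

lemma LJ_cut_deriv:
  assumes "\<delta> > 0"
  shows "(LJ_cut a \<delta> \<sigma> has_real_derivative LJ_sq' a \<sigma> (max s \<delta>)) (at s)"
proof -
  have "(LJ_cut a \<delta> \<sigma> has_vector_derivative
      (if s \<in> {..\<delta>} then LJ_sq' a \<sigma> \<delta> else LJ_sq' a \<sigma> s)) (at s within UNIV)"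
    unfolding LJ_cut_def[abs_def]
  proof (rule has_vector_derivative_If_within_closures[where T = "{\<delta><..}"
        and f' = "\<lambda>_. LJ_sq' a \<sigma> \<delta>" and g' = "LJ_sq' a \<sigma>"])
    show "s \<in> {..\<delta>} \<union> {\<delta><..}" "UNIV = {..\<delta>} \<union> {\<delta><..}" by auto
    show "((\<lambda>s. LJ_sq a \<sigma> \<delta> + LJ_sq' a \<sigma> \<delta> * (s - \<delta>)) has_vector_derivative LJ_sq' a \<sigma> \<delta>)
        (at s within {..\<delta>} \<union> closure {..\<delta>} \<inter> closure {\<delta><..})"
      by (auto intro!: derivative_eq_intros simp flip: has_real_derivative_iff_has_vector_derivative)
    assume "s \<in> {\<delta><..} \<union> closure {..\<delta>} \<inter> closure {\<delta><..}"
    then have "s > 0" using assms by auto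
    then show "(LJ_sq a \<sigma> has_vector_derivative LJ_sq' a \<sigma> s)
        (at s within {\<delta><..} \<union> closure {..\<delta>} \<inter> closure {\<delta><..})"
      by (simp add: LJ_sq_deriv flip: has_real_derivative_iff_has_vector_derivative)
  qed auto
  moreover have "(if s \<in> {..\<delta>} then LJ_sq' a \<sigma> \<delta> else LJ_sq' a \<sigma> s) = LJ_sq' a \<sigma> (max s \<delta>)"
    by auto
  ultimately show ?thesis
    by (simp add: has_real_derivative_iff_has_vector_derivative)
qed

text \<open>A line with nonpositive slope does not fall towards the left, so below
  \<open>\<delta>\<close> the tangent keeps at least its value at \<open>\<delta>\<close>.\<close>

lemma LJ_cut_ge:
  assumes "LJ_sq' a \<sigma> \<delta> \<le> 0" "s \<le> \<delta>"
  shows "LJ_sq a \<sigma> \<delta> \<le> LJ_cut a \<delta> \<sigma> s"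
  using assms by (simp add: LJ_cut_def mult_nonpos_nonpos)

text \<open>Repulsion dominates near 0: the potential tends to plus infinity and its slope to minus
  infinity. The \<open>eventually\<close> form lets one \<open>\<delta>\<close> serve finitely many
  pairs.\<close>

lemma LJ_sq_steep_near_0:
  assumes "a > 0" "\<sigma> > 0"
  shows "\<forall>\<^sub>F \<delta> in at_right 0. LJ_sq' a \<sigma> \<delta> \<le> 0 \<and> (\<forall>s. 0 < s \<longrightarrow> s \<le> \<delta> \<longrightarrow> K < LJ_sq a \<sigma> s)"
proof -
  have "filterlim (LJ_sq a \<sigma>) at_top (at_right 0)"
    unfolding LJ_sq_def[abs_def] using assms by real_asymp
  then have "\<forall>\<^sub>F s in at_right 0. K < LJ_sq a \<sigma> s"
    by (simp add: filterlim_at_top_dense)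
  moreover have "filterlim (LJ_sq' a \<sigma>) at_bot (at_right 0)"
    unfolding LJ_sq'_def[abs_def] using assms by real_asymp
  then have "\<forall>\<^sub>F s in at_right 0. LJ_sq' a \<sigma> s \<le> 0"
    by (simp add: filterlim_at_bot)
  ultimately have "\<forall>\<^sub>F s in at_right 0. K < LJ_sq a \<sigma> s \<and> LJ_sq' a \<sigma> s \<le> 0"
    by eventually_elim simp
  \<comment> \<open>Both properties hold on a full interval to the right of 0, so every
    \<open>\<delta>\<close> below \<open>b\<close> also controls all smaller
    \<open>s\<close>.\<close>
  then obtain b where "b > 0" "\<And>s. 0 < s \<Longrightarrow> s < b \<Longrightarrow> K < LJ_sq a \<sigma> s \<and> LJ_sq' a \<sigma> s \<le> 0"
    by (auto simp: eventually_at_right_field)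
  then show ?thesis by (auto simp: eventually_at_right_field intro!: exI[of _ b])
qed

text \<open>Cutting the squared distance at \<open>\<delta>\<close> means cutting the distance at
  \<open>sqrt \<delta>\<close>, so the force is a combination of the cut-off powers treated
  above.\<close>

lemma lipschitzian_LJ_cut_force:
  fixes \<delta> :: real
  assumes "\<delta> > 0"
  shows "lipschitzian (\<lambda>y::'a::real_normed_vector. (2 * LJ_sq' a \<sigma> (max ((norm y)\<^sup>2) \<delta>)) *\<^sub>R y)"
proof -
  define e where "e = sqrt \<delta>"
  have e: "e > 0" using assms by (simp add: e_def)
  define r where "r y = max (norm y) e" for y :: 'a
  have r: "r y > 0" for y using e by (simp add: r_def)
  have sq: "max ((norm y)\<^sup>2) \<delta> = (r y)\<^sup>2" for y :: 'a
  proof -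
    have "e\<^sup>2 = \<delta>" using assms by (simp add: e_def)
    moreover have "norm y \<le> e \<longleftrightarrow> (norm y)\<^sup>2 \<le> e\<^sup>2"
      using e by (simp add: abs_le_square_iff[symmetric])
    ultimately show ?thesis by (auto simp: r_def max_def)
  qed
  define P where "P n y = inverse (r y) ^ n *\<^sub>R (inverse (r y) *\<^sub>R y)" for n y
  have P: "lipschitzian (P n)" for n
    unfolding P_def r_def by (rule lipschitzian_cut_power(1)[OF e])
  \<comment> \<open>With \<open>s = (r y)\<^sup>2\<close> the powers \<open>s ^ 4\<close> and
    \<open>s ^ 7\<close> become 8 and 14 in \<open>r y\<close>; \<open>P n\<close> already carries
    one inverse factor, hence 7 and 13.\<close>
  have "(2 * LJ_sq' a \<sigma> (max ((norm y)\<^sup>2) \<delta>)) *\<^sub>R y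
      = (24 * a * \<sigma> ^ 6) *\<^sub>R P 7 y + (- 48 * a * \<sigma> ^ 12) *\<^sub>R P 13 y" for y
  proof -
    have "2 * LJ_sq' a \<sigma> ((r y)\<^sup>2) = 24 * a * \<sigma> ^ 6 * (inverse (r y) ^ 7 * inverse (r y))
        + - 48 * a * \<sigma> ^ 12 * (inverse (r y) ^ 13 * inverse (r y))"
      using r[of y] unfolding LJ_sq'_def power_mult[symmetric] divide_inverse power_inverse[symmetric]
      by (simp add: eval_nat_numeral algebra_simps)
    then show ?thesis unfolding sq P_def scaleR_scaleR scaleR_left_distrib[symmetric] by simp
  qed
  then show ?thesis
    by (simp only: lipschitzian_add lipschitzian_comp[OF lipschitzian_bounded_linear[OF bounded_linear_scaleR_right] P])
qed

lemma lipschitzian_pair_gradient: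
  fixes p' :: "'n::finite \<Rightarrow> 'n \<Rightarrow> real \<Rightarrow> real"
  assumes "\<And>i j. lipschitzian (\<lambda>y::real ^ 'd. (2 * p' i j ((norm y)\<^sup>2)) *\<^sub>R y)"
  shows "lipschitzian (pair_gradient p' :: ('d::finite, 'n) config \<Rightarrow> _)"
  unfolding pair_gradient_def[abs_def]
  by (intro lipschitzian_vec_lambda lipschitzian_sum
      lipschitzian_comp[OF assms lipschitzian_bounded_linear]
      bounded_linear_sub bounded_linear_vec_nth)

section \<open>Damped second-order systems with a general force\<close>

text \<open>A common form for the true and the modified system. Collisions are allowed, since the
  modified force is defined there too.\<close>

definition damped_solution ::
    "('n \<Rightarrow> real) \<Rightarrow> ('n \<Rightarrow> real) \<Rightarrow> (('d::finite, 'n::finite) config \<Rightarrow> ('d, 'n) config)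
      \<Rightarrow> ('d, 'n) config \<Rightarrow> ('d, 'n) config
      \<Rightarrow> (real \<Rightarrow> ('d, 'n) config) \<Rightarrow> (real \<Rightarrow> ('d, 'n) config) \<Rightarrow> (real \<Rightarrow> ('d, 'n) config) \<Rightarrow> bool" where
  "damped_solution m c G x0 v0 X V A \<longleftrightarrow>
    (\<forall>t\<ge>0. (X has_vector_derivative V t) (at t within {0..})) \<and>
    (\<forall>t\<ge>0. (V has_vector_derivative A t) (at t within {0..})) \<and>
    (\<forall>t\<ge>0. \<forall>i. m i *\<^sub>R (A t $ i) + c i *\<^sub>R (V t $ i) = - G (X t) $ i) \<and>
    X 0 = x0 \<and> V 0 = v0"

text \<open>Reduction to a first-order system for pairs of position and velocity, whose right-hand
  side inherits the Lipschitz property from \<open>G\<close>.\<close>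

lemma damped_solution_exists_unique:
  fixes G :: "('d::finite, 'n::finite) config \<Rightarrow> ('d, 'n) config"
  assumes G: "lipschitzian G" and m: "\<And>i. m i > 0"
  obtains X V A where
    "damped_solution m c G x0 v0 X V A" "continuous_on {0..} A"
    "\<forall>Y W B. damped_solution m c G x0 v0 Y W B \<longrightarrow> (\<forall>t\<ge>0. Y t = X t)"
proof -
  \<comment> \<open>The equation of motion solved for the acceleration, which is possible as the
    masses are positive.\<close>
  define acc :: "('d, 'n) config \<times> ('d, 'n) config \<Rightarrow> ('d, 'n) config"
    where "acc z = (\<chi> i. (- c i / m i) *\<^sub>R (snd z $ i) + (- 1 / m i) *\<^sub>R (G (fst z) $ i))" for z
  have acc_iff: "acc (x, v) = b \<longleftrightarrow> (\<forall>i. m i *\<^sub>R (b $ i) + c i *\<^sub>R (v $ i) = - G x $ i)" for x v b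
  proof -
    have "acc (x, v) $ i = b $ i \<longleftrightarrow> m i *\<^sub>R (b $ i) + c i *\<^sub>R (v $ i) = - G x $ i" for i
    proof -
      have "m i *\<^sub>R (acc (x, v) $ i) + c i *\<^sub>R (v $ i) = - G x $ i"
        using m[of i] by (simp add: acc_def scaleR_right_diff_distrib)
      moreover have "acc (x, v) $ i = b $ i \<longleftrightarrow>
          m i *\<^sub>R (b $ i) + c i *\<^sub>R (v $ i) = m i *\<^sub>R (acc (x, v) $ i) + c i *\<^sub>R (v $ i)"
        using m[of i] by auto
      ultimately show ?thesis by simp
    qed
    then show ?thesis by (simp add: vec_eq_iff[of "acc (x, v)"])
  qed
  have comp: "lipschitzian (\<lambda>z. k *\<^sub>R (f z $ i))"
    if "lipschitzian f" for k i and f :: "('d, 'n) config \<times> ('d, 'n) config \<Rightarrow> ('d, 'n) config"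
    by (rule lipschitzian_comp[OF lipschitzian_bounded_linear that])
      (intro bounded_linear_compose[OF bounded_linear_scaleR_right] bounded_linear_vec_nth)
  have acc: "lipschitzian acc"
    unfolding acc_def[abs_def]
    by (intro lipschitzian_vec_lambda lipschitzian_add comp lipschitzian_comp[OF G]
        lipschitzian_bounded_linear bounded_linear_fst bounded_linear_snd)
  have "lipschitzian (\<lambda>z. (snd z, acc z))"
    by (intro lipschitzian_Pair acc lipschitzian_bounded_linear bounded_linear_snd)
  then obtain L where L: "L-lipschitz_on UNIV (\<lambda>z. (snd z, acc z))"
    unfolding lipschitzian_def by blast
  obtain z where z0: "z 0 = (x0, v0)"
    and z: "\<And>t. t \<ge> 0 \<Longrightarrow> (z has_vector_derivative (snd (z t), acc (z t))) (at t within {0..})"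
    using global_lipschitz_ode_exists[OF L, of "(x0, v0)"] by blast
  show ?thesis
  proof
    have "((\<lambda>t. fst (z t)) has_vector_derivative snd (z t)) (at t within {0..})" if "t \<ge> 0" for t
      using bounded_linear.has_vector_derivative[OF bounded_linear_fst z[OF that]] by simp
    moreover have "((\<lambda>t. snd (z t)) has_vector_derivative acc (z t)) (at t within {0..})" if "t \<ge> 0" for t
      using bounded_linear.has_vector_derivative[OF bounded_linear_snd z[OF that]] by simp
    moreover have "m i *\<^sub>R (acc (z t) $ i) + c i *\<^sub>R (snd (z t) $ i) = - G (fst (z t)) $ i" for t i
      using acc_iff[of "fst (z t)" "snd (z t)" "acc (z t)"] by simp
    ultimately show "damped_solution m c G x0 v0 (\<lambda>t. fst (z t)) (\<lambda>t. snd (z t)) (\<lambda>t. acc (z t))"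
      by (simp add: damped_solution_def z0)
    obtain M where "M-lipschitz_on UNIV acc" using acc unfolding lipschitzian_def by blast
    then have "continuous_on UNIV acc" by (rule lipschitz_on_continuous_on)
    moreover have "continuous_on {0..} z"
      by (auto intro: continuous_on_vector_derivative z)
    ultimately show "continuous_on {0..} (\<lambda>t. acc (z t))"
      by (rule continuous_on_compose2) auto
    have "Y t = fst (z t)" if Y: "damped_solution m c G x0 v0 Y W B" and t: "t \<ge> 0" for Y W B t
    proof -
      have "(Y t, W t) = z t"
      proof (rule global_lipschitz_ode_unique[OF L _ z _ t])
        fix t :: real assume t: "t \<ge> 0"
        have "acc (Y t, W t) = B t" using Y t acc_iff unfolding damped_solution_def by blast
        moreover have "((\<lambda>t. (Y t, W t)) has_vector_derivative (W t, B t)) (at t within {0..})"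
          using Y t by (auto simp: damped_solution_def intro: has_vector_derivative_Pair)
        ultimately show "((\<lambda>t. (Y t, W t)) has_vector_derivative (snd (Y t, W t), acc (Y t, W t))) (at t within {0..})"
          by simp
      qed (use Y in \<open>simp_all add: damped_solution_def z0\<close>)
      then show "Y t = fst (z t)" by (metis fst_conv)
    qed
    then show "\<forall>Y W B. damped_solution m c G x0 v0 Y W B \<longrightarrow> (\<forall>t\<ge>0. Y t = fst (z t))"
      by blast
  qed
qed

text \<open>Dropping the nonnegative kinetic energy from the energy inequality bounds the total
  potential, and the lower bound on all pairs passes this to each single pair. The right-hand side
  depends on the initial data only.\<close>

lemma damped_pair_bound:
  fixes X :: "real \<Rightarrow> ('d::finite, 'n::{finite,linorder}) config"
  assumes X: "damped_solution m c (pair_gradient p') x0 v0 X V A"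
    and m: "\<And>i. m i \<ge> 0" and c: "\<And>i. c i \<ge> 0"
    and sym: "\<And>i j s. p i j s = p j i s" "\<And>i j s. p' i j s = p' j i s"
    and deriv: "\<And>t i j. t \<ge> 0 \<Longrightarrow> i \<noteq> j \<Longrightarrow>
      (p i j has_real_derivative p' i j ((norm (X t $ i - X t $ j))\<^sup>2)) (at ((norm (X t $ i - X t $ j))\<^sup>2))"
    and lower: "\<And>i j s. - b \<le> p i j s" and "b \<ge> 0" "t \<ge> 0" "i \<noteq> j"
  shows "p i j ((norm (X t $ i - X t $ j))\<^sup>2)
    \<le> 1 / 2 * (\<Sum>i\<in>UNIV. m i * (norm (v0 $ i))\<^sup>2) + pair_total p x0 + b * (real CARD('n))\<^sup>2"
proof -
  have "1 / 2 * (\<Sum>i\<in>UNIV. m i * (norm (V t $ i))\<^sup>2) + pair_total p (X t)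
    \<le> 1 / 2 * (\<Sum>i\<in>UNIV. m i * (norm (V 0 $ i))\<^sup>2) + pair_total p (X 0)"
    using X unfolding damped_solution_def
    by (intro damped_energy_nonincreasing[OF _ _ GDERIV_pair_total[OF sym(2) deriv] _ c \<open>t \<ge> 0\<close>, of _ _ A])
      auto
  moreover have "X 0 = x0" "V 0 = v0" using X by (simp_all add: damped_solution_def)
  moreover have "0 \<le> 1 / 2 * (\<Sum>i\<in>UNIV. m i * (norm (V t $ i))\<^sup>2)"
    by (simp add: sum_nonneg m)
  moreover have "p i j ((norm (X t $ i - X t $ j))\<^sup>2) \<le> pair_total p (X t) + b * (real CARD('n))\<^sup>2"
    by (rule pair_le_pair_total[OF sym(1) lower \<open>b \<ge> 0\<close> \<open>i \<noteq> j\<close>])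
  ultimately show ?thesis by simp
qed

section \<open>Transfer of well-posedness from the modified to the true Lennard-Jones system\<close>

theorem mainTheorem1:
  fixes m c q :: "'n::{finite,linorder} \<Rightarrow> real"
    and a :: real
    and x0 v0 :: "('d::finite, 'n) config"
  assumes "CARD('d) \<in> {2, 3}"
    and "CARD('n) \<ge> 2"
    and "\<And>i. m i > 0"
    and "\<And>i. c i > 0"
    and "\<And>i. q i > 0"
    and "a > 0"
    and "\<And>i j. i \<noteq> j \<Longrightarrow> x0 $ i \<noteq> x0 $ j"
  shows "ereal (LJ_energy m a q x0 v0) < \<infinity> \<and>
    (\<exists>X. LJ_solution m c a q x0 v0 X \<and>
         (\<forall>t\<ge>0. X t \<notin> collision_set) \<and>
         (\<forall>Y. LJ_solution m c a q x0 v0 Y \<longrightarrow> (\<forall>t\<ge>0. Y t = X t)))"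
proof -
  note m = assms(3) and c = assms(4) and q = assms(5) and a = \<open>a > 0\<close>
  define \<sigma> where "\<sigma> = LJ_sigma q"
  have \<sigma>: "\<sigma> i j > 0" for i j using q[of i] q[of j] by (simp add: \<sigma>_def LJ_sigma_def)
  have \<sigma>_sym: "\<sigma> i j = \<sigma> j i" for i j by (simp add: \<sigma>_def LJ_sigma_def add.commute)
  define p p' where "p i j = LJ_sq a (\<sigma> i j)" and "p' i j = LJ_sq' a (\<sigma> i j)" for i j
  have total: "LJ_total a q = (pair_total p :: ('d, 'n) config \<Rightarrow> real)"
    by (simp add: fun_eq_iff LJ_total_def pair_total_def p_def \<sigma>_def LJ_pot_norm)
  define dist2 where "dist2 i j x = (norm (x $ i - x $ j))\<^sup>2" for i j and x :: "('d, 'n) config"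
  have dist2_pos: "x \<notin> collision_set \<longleftrightarrow> (\<forall>i j. i \<noteq> j \<longrightarrow> dist2 i j x > 0)"
    for x
    by (auto simp: collision_set_def dist2_def)
  have x0: "dist2 i j x0 > 0" if "i \<noteq> j" for i j
    using assms(7)[OF that] by (simp add: dist2_def)
  \<comment> \<open>The right-hand side of \<open>damped_pair_bound\<close> with
    \<open>b = a\<close>, the lower bound from \<open>LJ_sq_ge\<close>.\<close>
  define K where "K = LJ_energy m a q x0 v0 + a * (real CARD('n))\<^sup>2"

  \<comment> \<open>Three demands on \<open>\<delta>\<close>: the initial distances lie beyond it,
    the tangents there do not rise, and the true potentials exceed \<open>K\<close> up to
    it.\<close>
  have "\<forall>\<^sub>F \<delta> in at_right 0. \<forall>i j. (i \<noteq> j \<longrightarrow> \<delta> < dist2 i j x0) \<and>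
      p' i j \<delta> \<le> 0 \<and> (\<forall>s. 0 < s \<longrightarrow> s \<le> \<delta> \<longrightarrow> K < p i j s)"
    unfolding p_def p'_def
    by (intro eventually_all_finite eventually_conj LJ_sq_steep_near_0 a \<sigma>)
      (auto intro!: order_tendstoD(2)[OF tendsto_ident_at] x0)
  with eventually_at_right_less[of "0::real"]
  have "\<forall>\<^sub>F \<delta> in at_right 0. 0 < \<delta> \<and> (\<forall>i j. (i \<noteq> j \<longrightarrow> \<delta> < dist2 i j x0) \<and>
      p' i j \<delta> \<le> 0 \<and> (\<forall>s. 0 < s \<longrightarrow> s \<le> \<delta> \<longrightarrow> K < p i j s))"
    by (rule eventually_conj)
  from eventually_happens'[OF trivial_limit_at_right_real this]
  obtain \<delta> where \<delta>: "\<delta> > 0" "\<And>i j. i \<noteq> j \<Longrightarrow> \<delta> < dist2 i j x0" "\<And>i j. p' i j \<delta> \<le> 0"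
      "\<And>i j s. 0 < s \<Longrightarrow> s \<le> \<delta> \<Longrightarrow> K < p i j s"
    by blast

  define pc pc' where "pc i j = LJ_cut a \<delta> (\<sigma> i j)" and "pc' i j s = LJ_sq' a (\<sigma> i j) (max s \<delta>)" for i j s
  define G where "G = (pair_gradient pc' :: ('d, 'n) config \<Rightarrow> _)"
  \<comment> \<open>Up to \<open>\<delta>\<close> the tangent stays above
    \<open>p i j \<delta>\<close>, which exceeds \<open>K\<close> and is at least
    \<open>- a\<close>; beyond \<open>\<delta>\<close> the two profiles coincide.\<close>
  have pc_lower: "- a \<le> pc i j s" and pc_small: "s \<le> \<delta> \<Longrightarrow> K < pc i j s" for i j s
  proof -
    have "p i j \<delta> \<le> pc i j s" if "s \<le> \<delta>"
      using LJ_cut_ge \<delta>(3) that by (simp add: p_def p'_def pc_def)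
    moreover have "pc i j s = p i j s" if "\<not> s \<le> \<delta>"
      using that by (simp add: pc_def p_def LJ_cut_def)
    moreover have "- a \<le> p i j s" for s
      unfolding p_def by (rule LJ_sq_ge[OF a])
    ultimately show "- a \<le> pc i j s" "s \<le> \<delta> \<Longrightarrow> K < pc i j s"
      using \<delta>(4)[OF \<delta>(1) order_refl, of i j] by (metis order_trans, metis less_le_trans)
  qed
  have G_eq: "G x = pair_gradient p' x" if "\<And>i j. i \<noteq> j \<Longrightarrow> \<delta> < dist2 i j x" for x
    unfolding G_def pair_gradient_def
  proof (intro arg_cong[where f = vec_lambda] ext sum.cong refl)
    fix i j :: 'n assume "j \<in> UNIV - {i}"
    then have "\<delta> < dist2 i j x" using that[of i j] by auto
    then show "(2 * pc' i j ((norm (x $ i - x $ j))\<^sup>2)) *\<^sub>R (x $ i - x $ j)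
        = (2 * p' i j ((norm (x $ i - x $ j))\<^sup>2)) *\<^sub>R (x $ i - x $ j)"
      by (simp add: pc'_def p'_def dist2_def)
  qed
  have p_deriv: "(p i j has_real_derivative p' i j (dist2 i j x)) (at (dist2 i j x))"
    if "x \<notin> collision_set" "i \<noteq> j" for i j x
    unfolding p_def p'_def using that by (intro LJ_sq_deriv) (simp add: dist2_pos)
  have block: "block_gradient i (LJ_total a q) x = pair_gradient p' x $ i" if "x \<notin> collision_set"
    for i and x :: "('d, 'n) config"
    unfolding total
    by (rule block_gradient_eqI, rule GDERIV_pair_total)
      (auto simp: p'_def \<sigma>_sym intro: p_deriv[OF that, unfolded dist2_def p'_def])
  have K_eq: "K = 1 / 2 * (\<Sum>i\<in>UNIV. m i * (norm (v0 $ i))\<^sup>2) + pair_total p x0 + a * (real CARD('n))\<^sup>2"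
    by (simp add: K_def LJ_energy_def total)
  \<comment> \<open>Equal initial potentials make \<open>K\<close> the energy bound of the modified
    system as well.\<close>
  have "pc i j (dist2 i j x0) = p i j (dist2 i j x0)" if "i \<noteq> j" for i j
    using \<delta>(2)[OF that] by (simp add: pc_def p_def LJ_cut_def)
  then have pc_x0: "pair_total pc x0 = pair_total p x0"
    unfolding pair_total_def dist2_def by (intro sum.cong) auto

  have G_lipschitz: "lipschitzian G"
    unfolding G_def pc'_def
    by (rule lipschitzian_pair_gradient) (rule lipschitzian_LJ_cut_force[OF \<delta>(1)])
  obtain X V A where
      X: "damped_solution m c (pair_gradient pc') x0 v0 X V A" and A: "continuous_on {0..} A"
    and unique: "\<forall>Y W B. damped_solution m c (pair_gradient pc') x0 v0 Y W B \<longrightarrow> (\<forall>t\<ge>0. Y t = X t)"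
    by (rule damped_solution_exists_unique[OF G_lipschitz[unfolded G_def] m]) (rule that)
  \<comment> \<open>This bound and \<open>pc_small\<close> together exclude squared distances up to
    \<open>\<delta>\<close>.\<close>
  have "pc i j (dist2 i j (X t)) \<le> K" if "t \<ge> 0" "i \<noteq> j" for t i j
    unfolding dist2_def K_eq pc_x0[symmetric]
  proof (rule damped_pair_bound[OF X])
    show "(pc i j has_real_derivative pc' i j ((norm (X t $ i - X t $ j))\<^sup>2)) (at ((norm (X t $ i - X t $ j))\<^sup>2))" for t i j
      unfolding pc_def pc'_def by (rule LJ_cut_deriv[OF \<delta>(1)])
  qed (use that m c a in \<open>auto simp: pc_def[of _ _] pc'_def \<sigma>_sym less_imp_le pc_lower[unfolded pc_def]\<close>)
  then have X_sep: "\<delta> < dist2 i j (X t)" if "t \<ge> 0" "i \<noteq> j" for t i j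
    using pc_small that by (metis not_le)
  then have X_coll: "X t \<notin> collision_set" if "t \<ge> 0" for t
    using that \<delta>(1) unfolding dist2_pos by (meson less_trans)
  \<comment> \<open>Along \<open>X\<close> all distances lie beyond \<open>\<delta>\<close>, so
    \<open>G\<close> is the true gradient there, which \<open>block\<close> identifies with the
    block gradients.\<close>
  have X_solution: "LJ_solution m c a q x0 v0 X"
    using X A X_coll X_sep unfolding LJ_solution_def damped_solution_def G_def[symmetric]
    by (intro exI[of _ V] exI[of _ A]) (simp add: block G_eq)

  \<comment> \<open>\<open>\<delta>\<close> was fixed from the initial data alone, so the same
    threshold applies to any competitor \<open>Y\<close>. The energy bound, now for the true
    profile, makes \<open>Y\<close> a solution of the modified system, where uniqueness is
    known.\<close>
  have "Y t = X t" if Y_solution: "LJ_solution m c a q x0 v0 Y" and "t \<ge> 0" for Y t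
  proof -
    have Y_coll: "Y t \<notin> collision_set" if "t \<ge> 0" for t
      using Y_solution that unfolding LJ_solution_def by blast
    obtain W B where Y: "damped_solution m c (pair_gradient p') x0 v0 Y W B"
      using Y_solution block unfolding LJ_solution_def damped_solution_def by metis
    have "p i j (dist2 i j (Y t)) \<le> K" if "t \<ge> 0" "i \<noteq> j" for t i j
      unfolding dist2_def K_eq
    proof (rule damped_pair_bound[OF Y])
      show "(p i j has_real_derivative p' i j ((norm (Y t $ i - Y t $ j))\<^sup>2)) (at ((norm (Y t $ i - Y t $ j))\<^sup>2))"
        if "t \<ge> 0" "i \<noteq> j" for t i j
        using p_deriv[OF Y_coll] that by (simp add: dist2_def)
    qed (use that m c a in \<open>auto simp: p_def p'_def \<sigma>_sym less_imp_le LJ_sq_ge\<close>)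
    then have "\<delta> < dist2 i j (Y t)" if "t \<ge> 0" "i \<noteq> j" for t i j
      using \<delta>(4) Y_coll that unfolding dist2_pos by (metis not_le)
    then have "G (Y t) = pair_gradient p' (Y t)" if "t \<ge> 0" for t
      using that by (intro G_eq) blast
    with Y have "damped_solution m c (pair_gradient pc') x0 v0 Y W B"
      by (simp add: damped_solution_def G_def)
    with \<open>t \<ge> 0\<close> show "Y t = X t" using unique by blast
  qed
  moreover have "ereal (LJ_energy m a q x0 v0) < \<infinity>" by simp
  ultimately show ?thesis using X_solution X_coll by blast
qed

end
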